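(* Let $k$ be a field and $X$ a well-ordered set. With $S$ and $Irr(S)$ as defined in the context, the set $$Irr(S)=\{u\mid u\text{ is a normal }DD\text{-word}\}$$ is a $k$-basis of the free dendriform algebra $DD(X)$ generated by $X$. (That is, $Irr(S)$ equals the set of normal $DD$-words over $X$, and the images of these words in $DD(X)$ form a $k$-basis.)
   Context: A dendriform algebra over $k$ is a $k$-vector space with bilinear operations $\prec,\succ$ satisfying, for all $x,y,z$: $(x\succ y)\prec z=x\succ(y\prec z)$; $(x\prec y)\prec z=x\prec(y\prec z)+x\prec(y\succ z)$; $x\succ(y\succ z)=(x\succ y)\succ z+(x\prec y)\succ z$. $DD(X)$ is the free dendriform algebra on $X$. An $L$-algebra is a $k$-vector space with bilinear operations $\prec,\succ$ satisfying only the first identity. $L$-words over $X$ are the formal expressions built from elements of $X$ by the binary operations $\prec,\succ$. Normal $DD$-words are defined recursively: an $L$-word $u$ is a normal $DD$-word if (1) $u=x$ with $x\in X$; or (2) $u=x\prec v$ with $x\in X$, $v$ a normal $DD$-word; or (3) $u=x\succ v$ with $x\in X$, $v$ a normal $DD$-word; or (4) $u=(x\succ u_1)\succ u_2$ with $x\in X$ and $u_1,u_2$ normal $DD$-words. An $L$-word $u$ is a normal $L$-word if (i) $u=x\in X$; (ii) $u=v\succ w$ with $v,w$ normal $L$-words; or (iii) $u=v\prec w$ with $v,w$ normal $L$-words and $v$ not of the form $v_1\succ v_2$ with $v_1,v_2$ normal $L$-words. $N$ is the set of normal $L$-words. The free $L$-algebra $L(X)$ is the $k$-vector space with basis $N$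 and bilinear operations determined for $u,v\in N$ by: $u\succ v$ is the word $u\succ v$; $u\prec v=[u\prec v]$, where $[u\prec v]$ is the word $u\prec v$ if $u\in X$ or $u=u_1\prec u_2$, and $[u\prec v]=u_1\succ[u_2\prec v]$ if $u=u_1\succ u_2$. Ordering on $N$: write $\delta_1$ for $\succ$, $\delta_2$ for $\prec$, $\delta_2>\delta_1$; $|u|$ is the number of occurrences of elements of $X$ in $u$; $wt(u)=(1,x)$ if $u=x\in X$, and $wt(u)=(|u|,\delta_i,u_1,u_2)$ if $u=\delta_i(u_1,u_2)\in N$ (that is, $u=u_1\succ u_2$ for $i=1$, $u=u_1\prec u_2$ for $i=2$). Then $u>v$ iff $wt(u)>wt(v)$ lexicographically, by induction on $|u|+|v|$. For nonzero $f\in L(X)$, $\bar f$ is the largest normal $L$-word occurring in $f$. A $\star$-$L$-word is an $L$-word over $X\cup\{\star\}$ ($\star\notin X$) with exactly one occurrence of $\star$; $v|_s$ is obtained from $v$ by replacing $\star$ by $s\in L(X)$, and $v|_s$ is a normal $s$-word if $v|_{\bar s}\in N$ (the word obtained by replacing $\star$ by the word $\bar s$ is a normal $L$-word). $S\subset L(X)$ is the set of all the following elements, for $x,y,z,v\in N$ (operations taken in $L(X)$): $f_1(x,y,z)=(x\prec y)\prec z-x\prec(y\prec z)-x\prec(y\succ z)$, $f_2(x,y,z)=(x\prec y)\succ z+(x\succ y)\succ z-x\succ(y\succ z)$, $f_3(x,y,z,v)=((x\succ y)\succ z)\succ v-(x\succ y)\succ(z\succ v)+(x\succ(y\prec z))\succ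 v$. $Irr(S)=\{u\in N\mid u\ne v|_{\bar s}\text{ for all }s\in S\text{ and all normal }s\text{-words }v|_s\}$. The free dendriform algebra is identified with the quotient $DD(X)=L(X)/Id(S)$, where $Id(S)$ is the ideal of $L(X)$ generated by $S$. *)

theory Defs
  imports Complex_Main "HOL-Library.Poly_Mapping"
begin

section \<open>Words\<close>

datatype 'x lword =
    Gen 'x
  | WSucc "'x lword" "'x lword"  (infix \<open>[\<succ>]\<close> 70)
  | WPrec "'x lword" "'x lword"  (infix \<open>[\<prec>]\<close> 70)

inductive normal_DD :: "'x lword \<Rightarrow> bool" where
  "normal_DD (Gen x)"
| "normal_DD v \<Longrightarrow> normal_DD (Gen x [\<prec>] v)"
| "normal_DD v \<Longrightarrow> normal_DD (Gen x [\<succ>] v)"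
| "normal_DD u1 \<Longrightarrow> normal_DD u2 \<Longrightarrow> normal_DD ((Gen x [\<succ>] u1) [\<succ>] u2)"

text \<open>In the last clause \<open>v\<close> is normal, so \<open>v = v1 [\<succ>] v2\<close> already forces \<open>v1\<close> and \<open>v2\<close>
  to be normal.\<close>

primrec normal_L :: "'x lword \<Rightarrow> bool" where
  "normal_L (Gen x) \<longleftrightarrow> True"
| "normal_L (v [\<succ>] w) \<longleftrightarrow> normal_L v \<and> normal_L w"
| "normal_L (v [\<prec>] w) \<longleftrightarrow> normal_L v \<and> normal_L w \<and> (\<nexists>v1 v2. v = v1 [\<succ>] v2)"

fun bracket_prec :: "'x lword \<Rightarrow> 'x lword \<Rightarrow> 'x lword" where
  "bracket_prec (u1 [\<succ>] u2) v = u1 [\<succ>] bracket_prec u2 v"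
| "bracket_prec u v = u [\<prec>] v"

lemma normal_L_bracket_prec:
  "normal_L u \<Longrightarrow> normal_L v \<Longrightarrow> normal_L (bracket_prec u v)"
  by (induction u v rule: bracket_prec.induct) auto


section \<open>The ordering\<close>

primrec wlen :: "'x lword \<Rightarrow> nat" where
  "wlen (Gen x) = 1"
| "wlen (u [\<succ>] v) = wlen u + wlen v"
| "wlen (u [\<prec>] v) = wlen u + wlen v"

lemma wlen_pos [simp]: "0 < wlen u"
  by (induction u) auto

text \<open>Lexicographic comparison of the weights \<open>(1, x)\<close> and \<open>(|u|, \<delta>, u1, u2)\<close>, where the
  operation \<open>\<prec>\<close> counts as larger than \<open>\<succ>\<close>. Words of length 1 are exactly the generators, so a
  generator and a product are always separated by the first component.\<close>

fun wless :: "'x::linorder lword \<Rightarrow> 'x lword \<Rightarrow> bool" where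
  "wless (Gen x) (Gen y) \<longleftrightarrow> x < y"
| "wless (Gen x) (u [\<succ>] v) \<longleftrightarrow> True"
| "wless (Gen x) (u [\<prec>] v) \<longleftrightarrow> True"
| "wless (u [\<succ>] v) (Gen x) \<longleftrightarrow> False"
| "wless (u [\<prec>] v) (Gen x) \<longleftrightarrow> False"
| "wless (u1 [\<succ>] u2) (v1 [\<succ>] v2) \<longleftrightarrow>
     wlen (u1 [\<succ>] u2) < wlen (v1 [\<succ>] v2) \<or>
     wlen (u1 [\<succ>] u2) = wlen (v1 [\<succ>] v2) \<and> (wless u1 v1 \<or> u1 = v1 \<and> wless u2 v2)"
| "wless (u1 [\<prec>] u2) (v1 [\<prec>] v2) \<longleftrightarrow>
     wlen (u1 [\<prec>] u2) < wlen (v1 [\<prec>] v2) \<or>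
     wlen (u1 [\<prec>] u2) = wlen (v1 [\<prec>] v2) \<and> (wless u1 v1 \<or> u1 = v1 \<and> wless u2 v2)"
| "wless (u1 [\<succ>] u2) (v1 [\<prec>] v2) \<longleftrightarrow> wlen (u1 [\<succ>] u2) \<le> wlen (v1 [\<prec>] v2)"
| "wless (u1 [\<prec>] u2) (v1 [\<succ>] v2) \<longleftrightarrow> wlen (u1 [\<prec>] u2) < wlen (v1 [\<succ>] v2)"

lemma wless_irrefl: "\<not> wless u u"
  by (induction u) auto

lemma wless_trans: "wless u v \<Longrightarrow> wless v w \<Longrightarrow> wless u w"
proof (induction u arbitrary: v w)
  case (Gen x)
  then show ?case by (cases v; cases w; simp)
next
  case (WSucc u1 u2)
  show ?case
  proof (cases "\<exists>a b c d. v = a [\<succ>] b \<and> w = c [\<succ>] d")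
    case True
    then obtain a b c d where "v = a [\<succ>] b" "w = c [\<succ>] d" by blast
    then show ?thesis
      using WSucc.prems WSucc.IH(1)[of a c] WSucc.IH(2)[of b d] by auto
  next
    case False
    then show ?thesis using WSucc.prems by (cases v; cases w; simp; linarith)
  qed
next
  case (WPrec u1 u2)
  show ?case
  proof (cases "\<exists>a b c d. v = a [\<prec>] b \<and> w = c [\<prec>] d")
    case True
    then obtain a b c d where "v = a [\<prec>] b" "w = c [\<prec>] d" by blast
    then show ?thesis
      using WPrec.prems WPrec.IH(1)[of a c] WPrec.IH(2)[of b d] by auto
  next
    case False
    then show ?thesis using WPrec.prems by (cases v; cases w; simp; linarith)
  qed
qed

lemma wless_linear: "wless u v \<or> u = v \<or> wless v u"
proof (induction u arbitrary: v)
  case (Gen x)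
  then show ?case by (cases v) auto
next
  case (WSucc u1 u2)
  show ?case
  proof (cases v)
    case (WSucc v1 v2)
    then show ?thesis using WSucc.IH(1)[of v1] WSucc.IH(2)[of v2] by auto
  qed auto
next
  case (WPrec u1 u2)
  show ?case
  proof (cases v)
    case (WPrec v1 v2)
    then show ?thesis using WPrec.IH(1)[of v1] WPrec.IH(2)[of v2] by auto
  qed auto
qed

instantiation lword :: (linorder) linorder
begin

definition less_lword :: "'a lword \<Rightarrow> 'a lword \<Rightarrow> bool" where
  "u < v \<longleftrightarrow> wless u v"

definition less_eq_lword :: "'a lword \<Rightarrow> 'a lword \<Rightarrow> bool" where
  "u \<le> v \<longleftrightarrow> wless u v \<or> u = v"

instance
proof
  fix u v w :: "'a lword"
  show "u < v \<longleftrightarrow> u \<le> v \<and> \<not> v \<le> u"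
    unfolding less_lword_def less_eq_lword_def using wless_irrefl wless_trans by blast
  show "u \<le> u" by (simp add: less_eq_lword_def)
  show "u \<le> w" if "u \<le> v" "v \<le> w"
    using that unfolding less_eq_lword_def using wless_trans by blast
  show "u = v" if "u \<le> v" "v \<le> u"
    using that unfolding less_eq_lword_def using wless_irrefl wless_trans by blast
  show "u \<le> v \<or> v \<le> u"
    unfolding less_eq_lword_def using wless_linear by blast
qed

end

typedef 'x nword = "{u :: 'x lword. normal_L u}"
  morphisms word_of nword_of
  by (rule exI[of _ "Gen undefined"]) simp

setup_lifting type_definition_nword

instantiation nword :: (linorder) linorder
begin

lift_definition less_nword :: "'a nword \<Rightarrow> 'a nword \<Rightarrow> bool" is "(<)" .

lift_definition less_eq_nword :: "'a nword \<Rightarrow> 'a nword \<Rightarrow> bool" is "(\<le>)" .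

instance
  by standard (transfer; auto)+

end

lift_definition ngen :: "'x \<Rightarrow> 'x nword" is Gen by simp

lift_definition nsucc :: "'x nword \<Rightarrow> 'x nword \<Rightarrow> 'x nword" is "([\<succ>])" by simp

lift_definition nprec :: "'x nword \<Rightarrow> 'x nword \<Rightarrow> 'x nword" is bracket_prec
  by (rule normal_L_bracket_prec)


section \<open>The free L-algebra\<close>

type_synonym ('x, 'k) free_L = "'x nword \<Rightarrow>\<^sub>0 'k"

definition L_scale :: "'k::field \<Rightarrow> ('x, 'k) free_L \<Rightarrow> ('x, 'k) free_L" where
  "L_scale c f = Poly_Mapping.map ((*) c) f"

definition L_word :: "'x nword \<Rightarrow> ('x, 'k::field) free_L" where
  "L_word u = Poly_Mapping.single u 1"

definition bilinear_ext ::
    "('x nword \<Rightarrow> 'x nword \<Rightarrow> 'x nword) \<Rightarrow> ('x, 'k::field) free_L \<Rightarrow> ('x, 'k) free_L \<Rightarrow> ('x, 'k) free_L"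
  where "bilinear_ext m f g =
    (\<Sum>u\<in>Poly_Mapping.keys f. \<Sum>v\<in>Poly_Mapping.keys g.
       L_scale (Poly_Mapping.lookup f u * Poly_Mapping.lookup g v) (L_word (m u v)))"

definition L_succ :: "('x, 'k::field) free_L \<Rightarrow> ('x, 'k) free_L \<Rightarrow> ('x, 'k) free_L"
    (infix \<open>\<succ>\<close> 70)
  where "f \<succ> g = bilinear_ext nsucc f g"

definition L_prec :: "('x, 'k::field) free_L \<Rightarrow> ('x, 'k) free_L \<Rightarrow> ('x, 'k) free_L"
    (infix \<open>\<prec>\<close> 70)
  where "f \<prec> g = bilinear_ext nprec f g"

text \<open>\<open>lead f\<close> is only meaningful for \<open>f \<noteq> 0\<close>.\<close>

definition lead :: "('x::linorder, 'k::field) free_L \<Rightarrow> 'x nword" where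
  "lead f = Max (Poly_Mapping.keys f)"

lemma lookup_L_scale [simp]: "Poly_Mapping.lookup (L_scale c f) u = c * Poly_Mapping.lookup f u"
  by (simp add: L_scale_def Poly_Mapping.map.rep_eq when_def)

interpretation L: vector_space "L_scale :: 'k::field \<Rightarrow> ('x, 'k) free_L \<Rightarrow> ('x, 'k) free_L"
  by unfold_locales (auto intro!: poly_mapping_eqI simp: lookup_add algebra_simps)

definition (in vector_space) lin_ext :: "('x nword \<Rightarrow> 'b) \<Rightarrow> ('x, 'a) free_L \<Rightarrow> 'b" where
  "lin_ext \<phi> f = (\<Sum>u\<in>Poly_Mapping.keys f. scale (Poly_Mapping.lookup f u) (\<phi> u))"

lemma (in vector_space) lin_ext_word: "lin_ext \<phi> (L_word u) = \<phi> u"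
  by (simp add: lin_ext_def L_word_def)

lemma (in vector_space) linear_lin_ext: "Vector_Spaces.linear L_scale scale (lin_ext \<phi>)"
proof -
  have "lin_ext \<phi> (f + g) = lin_ext \<phi> f + lin_ext \<phi> g" for f g
    unfolding lin_ext_def
    by (rule setsum_keys_plus_distrib) (simp_all add: scale_left_distrib)
  moreover have "lin_ext \<phi> (L_scale c f) = scale c (lin_ext \<phi> f)" for c f
  proof -
    have "lin_ext \<phi> (L_scale c f) =
        (\<Sum>u\<in>Poly_Mapping.keys f. scale (Poly_Mapping.lookup (L_scale c f) u) (\<phi> u))"
      unfolding lin_ext_def
      by (rule sum.mono_neutral_left) (auto simp: in_keys_iff)
    then show ?thesis by (simp add: lin_ext_def scale_sum_right)
  qed
  ultimately show ?thesis
    by (simp add: Vector_Spaces.linear_iff L.vector_space_axioms vector_space_axioms)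
qed

lemma bilinear_ext_left:
  "bilinear_ext m f g = L.lin_ext (\<lambda>u. L.lin_ext (\<lambda>v. L_word (m u v)) g) f"
  by (simp add: bilinear_ext_def L.lin_ext_def L.scale_sum_right)

lemma bilinear_ext_right:
  "bilinear_ext m f g = L.lin_ext (\<lambda>v. L.lin_ext (\<lambda>u. L_word (m u v)) f) g"
  unfolding bilinear_ext_def L.lin_ext_def L.scale_sum_right
  by (subst sum.swap) (simp add: mult.commute)

interpretation succ_left: Vector_Spaces.linear L_scale L_scale
    "\<lambda>f :: ('x, 'k::field) free_L. f \<succ> g" for g
  unfolding L_succ_def bilinear_ext_left by (rule L.linear_lin_ext)

interpretation succ_right: Vector_Spaces.linear L_scale L_scale
    "\<lambda>g :: ('x, 'k::field) free_L. f \<succ> g" for f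
  unfolding L_succ_def bilinear_ext_right by (rule L.linear_lin_ext)

interpretation prec_left: Vector_Spaces.linear L_scale L_scale
    "\<lambda>f :: ('x, 'k::field) free_L. f \<prec> g" for g
  unfolding L_prec_def bilinear_ext_left by (rule L.linear_lin_ext)

interpretation prec_right: Vector_Spaces.linear L_scale L_scale
    "\<lambda>g :: ('x, 'k::field) free_L. f \<prec> g" for f
  unfolding L_prec_def bilinear_ext_right by (rule L.linear_lin_ext)

lemmas linear_simps =
  succ_left.add succ_right.add prec_left.add prec_right.add
  succ_left.scale succ_right.scale prec_left.scale prec_right.scale

lemma L_succ_word [simp]: "L_word u \<succ> L_word v = L_word (nsucc u v)"
  by (simp add: L_succ_def bilinear_ext_left L.lin_ext_word)

lemma L_prec_word [simp]: "L_word u \<prec> L_word v = L_word (nprec u v)"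
  by (simp add: L_prec_def bilinear_ext_left L.lin_ext_word)

lemma free_L_induct [case_names word add scale]:
  fixes f :: "('x, 'k::field) free_L"
  assumes word: "\<And>u. P (L_word u)"
    and add: "\<And>f g. P f \<Longrightarrow> P g \<Longrightarrow> P (f + g)"
    and scale: "\<And>c f. P f \<Longrightarrow> P (L_scale c f)"
  shows "P f"
proof (induction f rule: update_induct)
  case const
  have "P (L_scale 0 (L_word undefined))" by (rule scale, rule word)
  then show ?case by simp
next
  case (update f a b)
  have "Poly_Mapping.update a b f = f + L_scale b (L_word a)"
    using update(1) by (intro poly_mapping_eqI)
      (auto simp: lookup_add L_word_def lookup_single when_def update.rep_eq in_keys_iff)
  then show ?case using update add scale word by simp
qed


section \<open>The relations and the irreducible words\<close>

definition DD_f1 :: "'x nword \<Rightarrow> 'x nword \<Rightarrow> 'x nword \<Rightarrow> ('x, 'k::field) free_L" where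
  "DD_f1 x y z = (let x = L_word x; y = L_word y; z = L_word z in
     (x \<prec> y) \<prec> z - x \<prec> (y \<prec> z) - x \<prec> (y \<succ> z))"

definition DD_f2 :: "'x nword \<Rightarrow> 'x nword \<Rightarrow> 'x nword \<Rightarrow> ('x, 'k::field) free_L" where
  "DD_f2 x y z = (let x = L_word x; y = L_word y; z = L_word z in
     (x \<prec> y) \<succ> z + (x \<succ> y) \<succ> z - x \<succ> (y \<succ> z))"

definition DD_f3 :: "'x nword \<Rightarrow> 'x nword \<Rightarrow> 'x nword \<Rightarrow> 'x nword \<Rightarrow> ('x, 'k::field) free_L" where
  "DD_f3 x y z v = (let x = L_word x; y = L_word y; z = L_word z; v = L_word v in
     ((x \<succ> y) \<succ> z) \<succ> v - (x \<succ> y) \<succ> (z \<succ> v) + (x \<succ> (y \<prec> z)) \<succ> v)"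

definition S_DD :: "('x, 'k::field) free_L set" where
  "S_DD = {DD_f1 x y z | x y z. True} \<union>
     {DD_f2 x y z | x y z. True} \<union> {DD_f3 x y z v | x y z v. True}"

primrec occurrences :: "'a \<Rightarrow> 'a lword \<Rightarrow> nat" where
  "occurrences a (Gen b) = (if b = a then 1 else 0)"
| "occurrences a (u [\<succ>] v) = occurrences a u + occurrences a v"
| "occurrences a (u [\<prec>] v) = occurrences a u + occurrences a v"

text \<open>The alphabet extended by \<open>\<star>\<close> is \<open>'x option\<close>, with \<open>None\<close> in the role of \<open>\<star>\<close>.\<close>

definition star_word :: "'x option lword \<Rightarrow> bool" where
  "star_word v \<longleftrightarrow> occurrences None v = 1"

primrec replace_star :: "'x option lword \<Rightarrow> 'x lword \<Rightarrow> 'x lword" where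
  "replace_star (Gen a) s = (case a of None \<Rightarrow> s | Some x \<Rightarrow> Gen x)"
| "replace_star (u [\<succ>] v) s = replace_star u s [\<succ>] replace_star v s"
| "replace_star (u [\<prec>] v) s = replace_star u s [\<prec>] replace_star v s"

definition normal_s_word :: "('x::linorder, 'k::field) free_L \<Rightarrow> 'x option lword \<Rightarrow> bool" where
  "normal_s_word s v \<longleftrightarrow> star_word v \<and> normal_L (replace_star v (word_of (lead s)))"

definition Irr :: "('x::linorder, 'k::field) free_L set \<Rightarrow> 'x nword set" where
  "Irr S = {u. \<forall>s\<in>S. \<forall>v. normal_s_word s v \<longrightarrow> word_of u \<noteq> replace_star v (word_of (lead s))}"


section \<open>The quotient by the ideal generated by the relations\<close>

definition L_ideal :: "('x, 'k::field) free_L set \<Rightarrow> bool" where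
  "L_ideal I \<longleftrightarrow> L.subspace I \<and>
     (\<forall>f\<in>I. \<forall>g. f \<succ> g \<in> I \<and> g \<succ> f \<in> I \<and> f \<prec> g \<in> I \<and> g \<prec> f \<in> I)"

definition ideal_gen :: "('x, 'k::field) free_L set \<Rightarrow> ('x, 'k) free_L set" where
  "ideal_gen S = L_ideal hull S"

lemma L_ideal_ideal_gen: "L_ideal (ideal_gen S)"
  unfolding ideal_gen_def
proof (rule hull_in)
  fix T :: "('a, 'b) free_L set set"
  assume "Ball T L_ideal"
  then show "L_ideal (\<Inter>T)"
    by (auto simp: L_ideal_def intro!: L.subspace_Inter)
qed

lemma ideal_gen_superset: "S \<subseteq> ideal_gen S"
  unfolding ideal_gen_def by (rule hull_subset)

lemma ideal_gen_0: "0 \<in> ideal_gen S"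
  and ideal_gen_add: "f \<in> ideal_gen S \<Longrightarrow> g \<in> ideal_gen S \<Longrightarrow> f + g \<in> ideal_gen S"
  and ideal_gen_diff: "f \<in> ideal_gen S \<Longrightarrow> g \<in> ideal_gen S \<Longrightarrow> f - g \<in> ideal_gen S"
  and ideal_gen_minus: "f \<in> ideal_gen S \<Longrightarrow> - f \<in> ideal_gen S"
  and ideal_gen_scale: "f \<in> ideal_gen S \<Longrightarrow> L_scale c f \<in> ideal_gen S"
  and ideal_gen_succ1: "f \<in> ideal_gen S \<Longrightarrow> f \<succ> g \<in> ideal_gen S"
  and ideal_gen_succ2: "f \<in> ideal_gen S \<Longrightarrow> g \<succ> f \<in> ideal_gen S"
  and ideal_gen_prec1: "f \<in> ideal_gen S \<Longrightarrow> f \<prec> g \<in> ideal_gen S"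
  and ideal_gen_prec2: "f \<in> ideal_gen S \<Longrightarrow> g \<prec> f \<in> ideal_gen S"
  using L_ideal_ideal_gen[of S] L.subspace_0 L.subspace_add L.subspace_diff L.subspace_neg L.subspace_scale
  by (auto simp: L_ideal_def)

quotient_type (overloaded) ('x, 'k) DD = "('x, 'k::field) free_L" / "\<lambda>f g. f - g \<in> ideal_gen S_DD"
  morphisms rep_DD DD_class
proof (rule equivpI)
  show "reflp (\<lambda>f g :: ('x, 'k) free_L. f - g \<in> ideal_gen S_DD)"
    by (auto intro!: reflpI simp: ideal_gen_0)
  show "symp (\<lambda>f g :: ('x, 'k) free_L. f - g \<in> ideal_gen S_DD)"
    by (rule sympI) (metis ideal_gen_minus minus_diff_eq)
  show "transp (\<lambda>f g :: ('x, 'k) free_L. f - g \<in> ideal_gen S_DD)"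
  proof (rule transpI)
    fix f g h :: "('x, 'k) free_L"
    assume "f - g \<in> ideal_gen S_DD" "g - h \<in> ideal_gen S_DD"
    from ideal_gen_add[OF this] show "f - h \<in> ideal_gen S_DD" by simp
  qed
qed

definition DD_word :: "'x nword \<Rightarrow> ('x, 'k::field) DD" where
  "DD_word u = DD_class (L_word u)"

instantiation DD :: (type, field) ab_group_add
begin

lift_definition zero_DD :: "('a, 'b) DD" is 0 .

lift_definition plus_DD :: "('a, 'b) DD \<Rightarrow> ('a, 'b) DD \<Rightarrow> ('a, 'b) DD" is "(+)"
  subgoal for f f' g g'
    using ideal_gen_add[of "f - f'" S_DD "g - g'"] by (simp add: algebra_simps)
  done

lift_definition minus_DD :: "('a, 'b) DD \<Rightarrow> ('a, 'b) DD \<Rightarrow> ('a, 'b) DD" is "(-)"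
  subgoal for f f' g g'
    using ideal_gen_diff[of "f - f'" S_DD "g - g'"] by (simp add: algebra_simps)
  done

lift_definition uminus_DD :: "('a, 'b) DD \<Rightarrow> ('a, 'b) DD" is uminus
  subgoal for f f'
    using ideal_gen_minus[of "f - f'" S_DD] by (simp add: algebra_simps)
  done

instance
  by standard (transfer; simp add: ideal_gen_0 algebra_simps)+

end

lift_definition DD_scale :: "'k::field \<Rightarrow> ('x, 'k) DD \<Rightarrow> ('x, 'k) DD" is L_scale
  subgoal for c f f'
    using ideal_gen_scale[of "f - f'" S_DD c] by (simp add: L.scale_right_diff_distrib)
  done

lift_definition DD_succ :: "('x, 'k::field) DD \<Rightarrow> ('x, 'k) DD \<Rightarrow> ('x, 'k) DD" is "(\<succ>)"
proof -
  fix f f' g g' :: "('x, 'k) free_L"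
  assume "f - f' \<in> ideal_gen S_DD" "g - g' \<in> ideal_gen S_DD"
  then have "(f - f') \<succ> g + f' \<succ> (g - g') \<in> ideal_gen S_DD"
    by (intro ideal_gen_add ideal_gen_succ1 ideal_gen_succ2)
  then show "f \<succ> g - f' \<succ> g' \<in> ideal_gen S_DD"
    by (simp add: succ_left.diff succ_right.diff)
qed

lift_definition DD_prec :: "('x, 'k::field) DD \<Rightarrow> ('x, 'k) DD \<Rightarrow> ('x, 'k) DD" is "(\<prec>)"
proof -
  fix f f' g g' :: "('x, 'k) free_L"
  assume "f - f' \<in> ideal_gen S_DD" "g - g' \<in> ideal_gen S_DD"
  then have "(f - f') \<prec> g + f' \<prec> (g - g') \<in> ideal_gen S_DD"
    by (intro ideal_gen_add ideal_gen_prec1 ideal_gen_prec2)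
  then show "f \<prec> g - f' \<prec> g' \<in> ideal_gen S_DD"
    by (simp add: prec_left.diff prec_right.diff)
qed

interpretation DD: vector_space "DD_scale :: 'k::field \<Rightarrow> ('x, 'k) DD \<Rightarrow> ('x, 'k) DD"
  by unfold_locales
    (transfer; simp add: ideal_gen_0 L.scale_right_distrib L.scale_left_distrib)+


section \<open>The quotient is the free dendriform algebra\<close>

locale dendriform_algebra = vector_space scale
  for scale :: "'k::field \<Rightarrow> 'd::ab_group_add \<Rightarrow> 'd" +
  fixes succ prec :: "'d \<Rightarrow> 'd \<Rightarrow> 'd"
  assumes linear_succ_left: "Vector_Spaces.linear scale scale (\<lambda>x. succ x y)"
    and linear_succ_right: "Vector_Spaces.linear scale scale (\<lambda>y. succ x y)"
    and linear_prec_left: "Vector_Spaces.linear scale scale (\<lambda>x. prec x y)"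
    and linear_prec_right: "Vector_Spaces.linear scale scale (\<lambda>y. prec x y)"
    and succ_prec: "prec (succ x y) z = succ x (prec y z)"
    and prec_prec: "prec (prec x y) z = prec x (prec y z) + prec x (succ y z)"
    and succ_succ: "succ x (succ y z) = succ (succ x y) z + succ (prec x y) z"

lemma L_succ_prec: "(f \<succ> g) \<prec> h = f \<succ> (g \<prec> h)"
proof (induction f rule: free_L_induct)
  case (word u)
  show ?case
  proof (induction g rule: free_L_induct)
    case (word v)
    show ?case
    proof (induction h rule: free_L_induct)
      case (word w)
      have "nprec (nsucc u v) w = nsucc u (nprec v w)"
        by transfer simp
      then show ?case by simp
    qed (simp_all add: linear_simps)
  qed (simp_all add: linear_simps)
qed (simp_all add: linear_simps)

lemma DD_relation_1: "(f \<prec> g) \<prec> h - (f \<prec> (g \<prec> h) + f \<prec> (g \<succ> h)) \<in> ideal_gen S_DD"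
proof (induction f rule: free_L_induct)
  case (word u)
  show ?case
  proof (induction g rule: free_L_induct)
    case (word v)
    show ?case
    proof (induction h rule: free_L_induct)
      case (word w)
      have "DD_f1 u v w \<in> S_DD" unfolding S_DD_def by blast
      then have "DD_f1 u v w \<in> ideal_gen S_DD" by (rule subsetD[OF ideal_gen_superset])
      then show ?case by (simp add: DD_f1_def Let_def diff_diff_eq)
    next
      case (add f g)
      from ideal_gen_add[OF add] show ?case by (simp add: linear_simps algebra_simps)
    next
      case (scale c f)
      from ideal_gen_scale[OF scale, of c] show ?case by
      (simp add: linear_simps L.scale_right_diff_distrib L.scale_right_distrib)
    qed
  next
    case (add f g)
    from ideal_gen_add[OF add] show ?case by (simp add: linear_simps algebra_simps)
  next
    case (scale c f)
    from ideal_gen_scale[OF scale, of c] show ?case by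
      (simp add: linear_simps L.scale_right_diff_distrib L.scale_right_distrib)
  qed
next
  case (add f g)
  from ideal_gen_add[OF add] show ?case by (simp add: linear_simps algebra_simps)
next
  case (scale c f)
  from ideal_gen_scale[OF scale, of c] show ?case by
      (simp add: linear_simps L.scale_right_diff_distrib L.scale_right_distrib)
qed

lemma DD_relation_2: "f \<succ> (g \<succ> h) - ((f \<succ> g) \<succ> h + (f \<prec> g) \<succ> h) \<in> ideal_gen S_DD"
proof (induction f rule: free_L_induct)
  case (word u)
  show ?case
  proof (induction g rule: free_L_induct)
    case (word v)
    show ?case
    proof (induction h rule: free_L_induct)
      case (word w)
      have "DD_f2 u v w \<in> S_DD" unfolding S_DD_def by blast
      then have "DD_f2 u v w \<in> ideal_gen S_DD" by (rule subsetD[OF ideal_gen_superset])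
      from ideal_gen_minus[OF this] show ?case by (simp add: DD_f2_def Let_def algebra_simps)
    next
      case (add f g)
      from ideal_gen_add[OF add] show ?case by (simp add: linear_simps algebra_simps)
    next
      case (scale c f)
      from ideal_gen_scale[OF scale, of c] show ?case by
      (simp add: linear_simps L.scale_right_diff_distrib L.scale_right_distrib)
    qed
  next
    case (add f g)
    from ideal_gen_add[OF add] show ?case by (simp add: linear_simps algebra_simps)
  next
    case (scale c f)
    from ideal_gen_scale[OF scale, of c] show ?case by
      (simp add: linear_simps L.scale_right_diff_distrib L.scale_right_distrib)
  qed
next
  case (add f g)
  from ideal_gen_add[OF add] show ?case by (simp add: linear_simps algebra_simps)
next
  case (scale c f)
  from ideal_gen_scale[OF scale, of c] show ?case by
      (simp add: linear_simps L.scale_right_diff_distrib L.scale_right_distrib)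
qed

interpretation DD: dendriform_algebra
  "DD_scale :: 'k::field \<Rightarrow> ('x, 'k) DD \<Rightarrow> ('x, 'k) DD" DD_succ DD_prec
proof unfold_locales
  fix x y z :: "('x, 'k) DD"
  show "DD_prec (DD_succ x y) z = DD_succ x (DD_prec y z)"
    by transfer (simp add: L_succ_prec ideal_gen_0)
  show "DD_prec (DD_prec x y) z = DD_prec x (DD_prec y z) + DD_prec x (DD_succ y z)"
    by transfer (rule DD_relation_1)
  show "DD_succ x (DD_succ y z) = DD_succ (DD_succ x y) z + DD_succ (DD_prec x y) z"
    by transfer (rule DD_relation_2)
qed (transfer; simp add: linear_simps ideal_gen_0)+

context dendriform_algebra
begin

primrec eval_word :: "('x \<Rightarrow> 'd) \<Rightarrow> 'x lword \<Rightarrow> 'd" where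
  "eval_word \<phi> (Gen x) = \<phi> x"
| "eval_word \<phi> (u [\<succ>] v) = succ (eval_word \<phi> u) (eval_word \<phi> v)"
| "eval_word \<phi> (u [\<prec>] v) = prec (eval_word \<phi> u) (eval_word \<phi> v)"

lemma eval_bracket_prec:
  "eval_word \<phi> (bracket_prec u v) = prec (eval_word \<phi> u) (eval_word \<phi> v)"
  by (induction u v rule: bracket_prec.induct) (simp_all add: succ_prec)

definition eval_L :: "('x \<Rightarrow> 'd) \<Rightarrow> ('x, 'k) free_L \<Rightarrow> 'd" where
  "eval_L \<phi> = lin_ext (\<lambda>u. eval_word \<phi> (word_of u))"

sublocale sl: Vector_Spaces.linear scale scale "\<lambda>x. succ x y" for y by (rule linear_succ_left)
sublocale sr: Vector_Spaces.linear scale scale "\<lambda>y. succ x y" for x by (rule linear_succ_right)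
sublocale pl: Vector_Spaces.linear scale scale "\<lambda>x. prec x y" for y by (rule linear_prec_left)
sublocale pr: Vector_Spaces.linear scale scale "\<lambda>y. prec x y" for x by (rule linear_prec_right)

lemma eval_L_linear: "Vector_Spaces.linear L_scale scale (eval_L \<phi>)"
  unfolding eval_L_def by (rule linear_lin_ext)

lemma eval_L_simps [simp]:
  "eval_L \<phi> (L_word u) = eval_word \<phi> (word_of u)"
  "eval_L \<phi> (f + g) = eval_L \<phi> f + eval_L \<phi> g"
  "eval_L \<phi> (f - g) = eval_L \<phi> f - eval_L \<phi> g"
  "eval_L \<phi> (L_scale c f) = scale c (eval_L \<phi> f)"
  "eval_L \<phi> 0 = 0"
proof -
  interpret e: Vector_Spaces.linear L_scale scale "eval_L \<phi>" by (rule eval_L_linear)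
  show "eval_L \<phi> (f + g) = eval_L \<phi> f + eval_L \<phi> g"
    "eval_L \<phi> (f - g) = eval_L \<phi> f - eval_L \<phi> g"
    "eval_L \<phi> (L_scale c f) = scale c (eval_L \<phi> f)"
    "eval_L \<phi> 0 = 0"
    by (rule e.add e.diff e.scale e.zero)+
  show "eval_L \<phi> (L_word u) = eval_word \<phi> (word_of u)"
    by (simp add: eval_L_def lin_ext_word)
qed

lemma eval_L_succ: "eval_L \<phi> (f \<succ> g) = succ (eval_L \<phi> f) (eval_L \<phi> g)"
proof (induction f rule: free_L_induct)
  case (word u)
  show ?case
    by (induction g rule: free_L_induct)
      (simp_all add: linear_simps nsucc.rep_eq sr.add sr.scale)
qed (simp_all add: linear_simps sl.add sl.scale)

lemma eval_L_prec: "eval_L \<phi> (f \<prec> g) = prec (eval_L \<phi> f) (eval_L \<phi> g)"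
proof (induction f rule: free_L_induct)
  case (word u)
  show ?case
    by (induction g rule: free_L_induct)
      (simp_all add: linear_simps nprec.rep_eq eval_bracket_prec pr.add pr.scale)
qed (simp_all add: linear_simps pl.add pl.scale)

lemma eval_L_ideal: "f \<in> ideal_gen S_DD \<Longrightarrow> eval_L \<phi> f = 0"
proof -
  have "ideal_gen S_DD \<subseteq> {f. eval_L \<phi> f = 0}"
    unfolding ideal_gen_def
  proof (rule hull_minimal)
    show "S_DD \<subseteq> {f. eval_L \<phi> f = 0}"
      by (auto simp: S_DD_def DD_f1_def DD_f2_def DD_f3_def Let_def eval_L_succ eval_L_prec
          prec_prec succ_succ sl.add succ_prec simp del: L_succ_word L_prec_word)
    show "L_ideal {f. eval_L \<phi> f = 0}"
      by (auto simp: L_ideal_def L.subspace_def eval_L_succ eval_L_prec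
          sl.zero sr.zero pl.zero pr.zero)
  qed
  then show "f \<in> ideal_gen S_DD \<Longrightarrow> eval_L \<phi> f = 0" by auto
qed

lemma eval_L_cong: "f - g \<in> ideal_gen S_DD \<Longrightarrow> eval_L \<phi> f = eval_L \<phi> g"
  using eval_L_ideal[of "f - g" \<phi>] by simp

definition eval_DD :: "('x \<Rightarrow> 'd) \<Rightarrow> ('x, 'k) DD \<Rightarrow> 'd" where
  "eval_DD \<phi> a = eval_L \<phi> (rep_DD a)"

lemma eval_DD_class: "eval_DD \<phi> (DD_class f) = eval_L \<phi> f"
  unfolding eval_DD_def
  by (rule eval_L_cong) (rule Quotient3_rep_abs[OF Quotient3_DD], simp add: ideal_gen_0)

end

theorem DD_universal_property:
  fixes scale :: "'k::field \<Rightarrow> 'd::ab_group_add \<Rightarrow> 'd" and \<phi> :: "'x \<Rightarrow> 'd"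
  assumes "dendriform_algebra scale succ prec"
  shows "\<exists>!h :: ('x, 'k) DD \<Rightarrow> 'd. Vector_Spaces.linear DD_scale scale h \<and>
    (\<forall>a b. h (DD_succ a b) = succ (h a) (h b)) \<and>
    (\<forall>a b. h (DD_prec a b) = prec (h a) (h b)) \<and>
    (\<forall>x. h (DD_word (ngen x)) = \<phi> x)"
proof -
  interpret D: dendriform_algebra scale succ prec by fact
  let ?P = "\<lambda>h :: ('x, 'k) DD \<Rightarrow> 'd. Vector_Spaces.linear DD_scale scale h \<and>
    (\<forall>a b. h (DD_succ a b) = succ (h a) (h b)) \<and>
    (\<forall>a b. h (DD_prec a b) = prec (h a) (h b)) \<and>
    (\<forall>x. h (DD_word (ngen x)) = \<phi> x)"
  let ?e = "D.eval_DD \<phi> :: ('x, 'k) DD \<Rightarrow> 'd"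
  have add: "?e (a + b) = ?e a + ?e b" for a b
    by (induction a rule: DD.abs_induct; induction b rule: DD.abs_induct)
      (simp add: plus_DD.abs_eq D.eval_DD_class)
  have sc: "?e (DD_scale c a) = scale c (?e a)" for c a
    by (induction a rule: DD.abs_induct) (simp add: DD_scale.abs_eq D.eval_DD_class)
  have su: "?e (DD_succ a b) = succ (?e a) (?e b)" for a b
    by (induction a rule: DD.abs_induct; induction b rule: DD.abs_induct)
      (simp add: DD_succ.abs_eq D.eval_DD_class D.eval_L_succ)
  have pr: "?e (DD_prec a b) = prec (?e a) (?e b)" for a b
    by (induction a rule: DD.abs_induct; induction b rule: DD.abs_induct)
      (simp add: DD_prec.abs_eq D.eval_DD_class D.eval_L_prec)
  have "Vector_Spaces.linear DD_scale scale ?e"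
    by (simp add: Vector_Spaces.linear_iff add sc DD.vector_space_axioms D.vector_space_axioms)
  moreover have "?e (DD_word (ngen x)) = \<phi> x" for x
    by (simp add: DD_word_def D.eval_DD_class ngen.rep_eq)
  ultimately have "?P ?e" using su pr by blast
  moreover have "h = ?e" if h: "?P h" for h
  proof -
    interpret h: Vector_Spaces.linear DD_scale scale h using h by blast
    have on_word: "h (DD_word (nword_of u)) = D.eval_word \<phi> u" if "normal_L u" for u
      using that
    proof (induction u)
      case (Gen x)
      then show ?case using h by (simp add: ngen.abs_eq[symmetric] ngen_def[symmetric])
    next
      case (WSucc u v)
      then have "DD_word (nword_of (u [\<succ>] v)) =
          (DD_succ (DD_word (nword_of u)) (DD_word (nword_of v)) :: ('x, 'k) DD)"
        by (simp add: DD_word_def DD_succ.abs_eq nsucc.abs_eq eq_onp_def)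
      then show ?case using WSucc h by simp
    next
      case (WPrec u v)
      then have "bracket_prec u v = u [\<prec>] v" by (cases u) auto
      then have "DD_word (nword_of (u [\<prec>] v)) =
          (DD_prec (DD_word (nword_of u)) (DD_word (nword_of v)) :: ('x, 'k) DD)"
        using WPrec.prems by (simp add: DD_word_def DD_prec.abs_eq nprec.abs_eq eq_onp_def)
      then show ?case using WPrec h by simp
    qed
    have "h (DD_class f) = D.eval_L \<phi> f" for f
    proof (induction f rule: free_L_induct)
      case (word u)
      show ?case using on_word[of "word_of u"] word_of[of u]
        by (simp add: DD_word_def[symmetric] word_of_inverse)
    next
      case (add f g)
      then show ?case by (simp add: plus_DD.abs_eq[symmetric] h.add)
    next
      case (scale c f)
      then show ?case by (simp add: DD_scale.abs_eq[symmetric] h.scale)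
    qed
    then have "h a = ?e a" for a
      by (induction a rule: DD.abs_induct) (simp add: D.eval_DD_class)
    then show ?thesis by (rule ext)
  qed
  ultimately show ?thesis by (rule ex1I)
qed

end

(* Computing the leading words of the relations shows that a normal L-word is irreducible exactly if
   it is a normal DD-word. In any dendriform algebra the span of the values of normal DD-words is
   closed under both operations, by induction on the left factor; this gives the spanning part. For
   independence, the vector space with basis the normal DD-words is itself made into a dendriform
   algebra in which every normal DD-word evaluates to the corresponding basis vector, so the induced
   map from the free dendriform algebra separates these words. *)
theory Submission
  imports Defs
begin

section \<open>Irreducible words\<close>

lemma lead_eqI:
  assumes "Poly_Mapping.lookup f a \<noteq> 0" "\<And>u. Poly_Mapping.lookup f u \<noteq> 0 \<Longrightarrow> u \<le> a"
  shows "lead f = a"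
  unfolding lead_def using assms by (intro Max_eqI) (auto simp: in_keys_iff)

lemma lookup_L_word: "Poly_Mapping.lookup (L_word u) v = (if u = v then 1 else 0)"
  by (simp add: L_word_def lookup_single when_def)

lemma wlen_neq_0 [simp]: "wlen u \<noteq> 0"
  using wlen_pos[of u] by linarith

lemma wlen_bracket_prec [simp]: "wlen (bracket_prec u v) = wlen u + wlen v"
  by (induction u v rule: bracket_prec.induct) auto

lemma bracket_prec_not_succ: "\<nexists>a b. u = a [\<succ>] b \<Longrightarrow> bracket_prec u v = u [\<prec>] v"
  by (cases u) auto

lemma wless_wlen: "wlen u < wlen v \<Longrightarrow> wless u v"
  by (cases u; cases v) auto

text \<open>If \<open>x\<close> is a \<succ>-product, both sides share its left factor, which
  cancels. Otherwise both sides are \<prec>-products of equal length, and the smaller has the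
  shorter left factor, \<open>x\<close> against \<open>x [\<prec>] y\<close>.\<close>

lemma wless_bracket_prec_assoc:
  "wlen w = wlen y + wlen z \<Longrightarrow> wless (bracket_prec x w) (bracket_prec (bracket_prec x y) z)"
  by (induction x) (auto simp: wless_wlen)

lemma lead_DD_f1:
  "lead (DD_f1 x y z :: ('x::linorder, 'k::field) free_L) = nprec (nprec x y) z"
proof -
  have "nprec x (nprec y z) < nprec (nprec x y) z" "nprec x (nsucc y z) < nprec (nprec x y) z"
    by (transfer, simp add: less_lword_def wless_bracket_prec_assoc)+
  then show ?thesis
    by (intro lead_eqI)
      (auto simp: DD_f1_def Let_def lookup_L_word lookup_minus split: if_splits)
qed

text \<open>The term \<open>x \<succ> (y \<succ> z)\<close> is beaten because its left factor is
  shorter. The other two have the same right factor, so \<open>[x \<prec> y]\<close> competes with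
  \<open>x \<succ> y\<close>. If \<open>x = a \<succ> b\<close>, the bracket is
  \<open>a \<succ> [b \<prec> y]\<close> and loses because \<open>a\<close> is shorter than
  \<open>x\<close>; otherwise it is a \<prec>-product and wins by its operation.\<close>

lemma lead_DD_f2:
  "lead (DD_f2 x y z :: ('x::linorder, 'k::field) free_L) =
    (if \<exists>a b. word_of x = a [\<succ>] b then nsucc (nsucc x y) z else nsucc (nprec x y) z)"
proof -
  have less: "nsucc x (nsucc y z) < nsucc (nprec x y) z"
    by (transfer, simp add: less_lword_def wless_wlen)
  have less': "nsucc x (nsucc y z) < nsucc (nsucc x y) z"
    by (transfer, simp add: less_lword_def wless_wlen)
  have succ: "nsucc (nprec x y) z < nsucc (nsucc x y) z" if "\<exists>a b. word_of x = a [\<succ>] b"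
    using that by transfer (auto simp: less_lword_def wless_wlen)
  have prec: "nsucc (nsucc x y) z < nsucc (nprec x y) z" if "\<nexists>a b. word_of x = a [\<succ>] b"
    using that by transfer (auto simp: less_lword_def wless_wlen bracket_prec_not_succ)
  show ?thesis
  proof (cases "\<exists>a b. word_of x = a [\<succ>] b")
    case True
    have "lead (DD_f2 x y z :: ('x, 'k) free_L) = nsucc (nsucc x y) z"
      using less' succ[OF True] by (intro lead_eqI)
       (auto simp: DD_f2_def Let_def lookup_L_word lookup_minus lookup_add split: if_splits)
    with True show ?thesis by simp
  next
    case False
    have "lead (DD_f2 x y z :: ('x, 'k) free_L) = nsucc (nprec x y) z"
      using less prec[OF False] by (intro lead_eqI)
       (auto simp: DD_f2_def Let_def lookup_L_word lookup_minus lookup_add split: if_splits)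
    with False show ?thesis by simp
  qed
qed

lemma nprec_nsucc: "nprec (nsucc x y) z = nsucc x (nprec y z)"
  by transfer simp

text \<open>The identity \<open>(x \<succ> y) \<prec> z = x \<succ> (y \<prec> z)\<close> holds in
  the free L-algebra already, so only two families of leading words remain.\<close>

lemma DD_f3_eq_f2: "DD_f3 x y z v = DD_f2 (nsucc x y) z v"
  by (simp add: DD_f2_def DD_f3_def Let_def nprec_nsucc)

lemma S_DD_eq: "S_DD = {DD_f1 x y z | x y z. True} \<union> {DD_f2 x y z | x y z. True}"
  unfolding S_DD_def DD_f3_eq_f2 by blast

\<comment> \<open>Normal DD-words contain no leading word\<close>
inductive_simps normal_DD_simps [simp]:
  "normal_DD (Gen x)" "normal_DD (u [\<prec>] v)" "normal_DD (u [\<succ>] v)"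

lemma normal_DD_imp_normal_L: "normal_DD u \<Longrightarrow> normal_L u"
  by (induction rule: normal_DD.induct) auto

text \<open>Normality passes to the right factor of a \<succ>-product, which reduces to a word
  \<open>(x \<prec> y) \<prec> z\<close>; there the left factor of the outer \<prec> is not a
  generator.\<close>

lemma not_normal_DD_bracket_prec: "\<not> normal_DD (bracket_prec (bracket_prec x y) z)"
proof (induction x)
  case (WSucc a b)
  then show ?case by (cases "bracket_prec (bracket_prec b y) z") auto
qed auto

lemma not_normal_DD_lead:
  assumes "s \<in> (S_DD :: ('x::linorder, 'k::field) free_L set)"
  shows "\<not> normal_DD (word_of (lead s))"
proof -
  have "\<not> normal_DD (word_of (lead (DD_f1 x y z :: ('x, 'k) free_L)))" for x y z
    by (simp add: lead_DD_f1 nprec.rep_eq not_normal_DD_bracket_prec)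
  moreover have "\<not> normal_DD (word_of (lead (DD_f2 x y z :: ('x, 'k) free_L)))" for x y z
    by (auto simp: lead_DD_f2 nprec.rep_eq nsucc.rep_eq bracket_prec_not_succ)
  ultimately show ?thesis using assms by (auto simp: S_DD_eq)
qed

text \<open>Both factors of a normal DD-word are normal DD-words, hence so is every subword.\<close>

lemma normal_DD_replace_star:
  "normal_DD (replace_star v w) \<Longrightarrow> occurrences None v \<noteq> 0 \<Longrightarrow> normal_DD w"
proof (induction v)
  case (Gen a)
  then show ?case by (cases a) auto
next
  case (WSucc a b)
  then show ?case by auto
next
  case (WPrec a b)
  then show ?case by auto
qed

section \<open>Every other normal L-word contains a leading word\<close>

text \<open>Normality of the substituted word is left out, so that the notion is stable under all
  contexts. For normal words it is automatic, and the notion is then the complement of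
  \<open>Irr\<close>.\<close>

definition reducible :: "('x::linorder, 'k::field) free_L set \<Rightarrow> 'x lword \<Rightarrow> bool" where
  "reducible S u \<longleftrightarrow> (\<exists>s\<in>S. \<exists>v. star_word v \<and> u = replace_star v (word_of (lead s)))"

lemma word_of_Irr: "word_of ` Irr S = {u. normal_L u \<and> \<not> reducible S u}"
proof -
  have "u \<in> Irr S \<longleftrightarrow> \<not> reducible S (word_of u)" for u
    using word_of[of u] unfolding Irr_def reducible_def normal_s_word_def by auto
  then show ?thesis
    using word_of by (auto simp: image_iff) (metis nword_of_inverse mem_Collect_eq)
qed

lemma occurrences_map_Some [simp]: "occurrences None (map_lword Some u) = 0"
  by (induction u) auto

lemma replace_star_map_Some [simp]: "replace_star (map_lword Some u) s = u"
  by (induction u) auto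

lemma reducible_left:
  assumes "reducible S u"
  shows "reducible S (u [\<succ>] v)" "reducible S (u [\<prec>] v)"
proof -
  obtain s c where s: "s \<in> S" "star_word c" "u = replace_star c (word_of (lead s))"
    using assms unfolding reducible_def by blast
  \<comment> \<open>\<open>map_lword Some v\<close> is a copy of \<open>v\<close> without a star;
    substitution turns it back into \<open>v\<close>.\<close>
  show "reducible S (u [\<succ>] v)" unfolding reducible_def using s
    by (intro bexI[of _ s] exI[of _ "c [\<succ>] map_lword Some v"]) (auto simp: star_word_def)
  show "reducible S (u [\<prec>] v)" unfolding reducible_def using s
    by (intro bexI[of _ s] exI[of _ "c [\<prec>] map_lword Some v"]) (auto simp: star_word_def)
qed

lemma reducible_right:
  assumes "reducible S v"
  shows "reducible S (u [\<succ>] v)" "reducible S (u [\<prec>] v)"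
proof -
  obtain s c where s: "s \<in> S" "star_word c" "v = replace_star c (word_of (lead s))"
    using assms unfolding reducible_def by blast
  show "reducible S (u [\<succ>] v)" unfolding reducible_def using s
    by (intro bexI[of _ s] exI[of _ "map_lword Some u [\<succ>] c"]) (auto simp: star_word_def)
  show "reducible S (u [\<prec>] v)" unfolding reducible_def using s
    by (intro bexI[of _ s] exI[of _ "map_lword Some u [\<prec>] c"]) (auto simp: star_word_def)
qed

lemma reducible_lead: "s \<in> S \<Longrightarrow> reducible S (word_of (lead s))"
  unfolding reducible_def star_word_def by (intro bexI[of _ s] exI[of _ "Gen None"]) auto

text \<open>A factor that is not a normal DD-word is reducible by induction. If both factors are
  normal DD-words, the left one has a forbidden shape and the whole word is itself the leading word
  of a relation.\<close>

lemma reducible_if_not_normal_DD: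
  "normal_L u \<Longrightarrow> \<not> normal_DD u \<Longrightarrow> reducible (S_DD :: ('x::linorder, 'k::field) free_L set) u"
proof (induction u)
  case (Gen x)
  then show ?case by simp
next
  case (WSucc u v)
  show ?case
  proof (cases "normal_DD u \<and> normal_DD v")
    case True
    with WSucc.prems consider x a where "u = Gen x [\<prec>] a"
      | x a b where "u = (Gen x [\<succ>] a) [\<succ>] b"
      by (cases u) auto
    then show ?thesis
    proof cases
      case 1
      let ?s = "DD_f2 (ngen x) (nword_of a) (nword_of v) :: ('x, 'k) free_L"
      have "word_of (lead ?s) = u [\<succ>] v"
        using 1 WSucc.prems
        by (simp add: lead_DD_f2 nsucc.rep_eq nprec.rep_eq ngen.rep_eq nword_of_inverse)
      moreover have "?s \<in> S_DD" unfolding S_DD_eq by blast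
      ultimately show ?thesis by (metis reducible_lead)
    next
      case 2
      let ?s = "DD_f2 (nword_of (Gen x [\<succ>] a)) (nword_of b) (nword_of v) :: ('x, 'k) free_L"
      have "word_of (lead ?s) = u [\<succ>] v"
        using 2 WSucc.prems
        by (simp add: lead_DD_f2 nsucc.rep_eq nword_of_inverse)
      moreover have "?s \<in> S_DD" unfolding S_DD_eq by blast
      ultimately show ?thesis by (metis reducible_lead)
    qed
  next
    case False
    with WSucc show ?thesis by (auto intro: reducible_left reducible_right)
  qed
next
  case (WPrec u v)
  show ?case
  proof (cases "normal_DD u \<and> normal_DD v")
    case True
    \<comment> \<open>\<open>normal_L\<close> excludes a \<succ>-product on the left, and a
      generator there would make the word a normal DD-word.\<close>
    with WPrec.prems obtain x a where u: "u = Gen x [\<prec>] a"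
      by (cases u) auto
    let ?s = "DD_f1 (ngen x) (nword_of a) (nword_of v) :: ('x, 'k) free_L"
    have "word_of (lead ?s) = u [\<prec>] v"
      using u WPrec.prems
      by (simp add: lead_DD_f1 nprec.rep_eq ngen.rep_eq nword_of_inverse)
    moreover have "?s \<in> S_DD" unfolding S_DD_eq by blast
    ultimately show ?thesis by (metis reducible_lead)
  next
    case False
    with WPrec show ?thesis by (auto intro: reducible_left reducible_right)
  qed
qed

theorem Irr_S_DD: "word_of ` Irr (S_DD :: ('x::linorder, 'k::field) free_L set) = {u. normal_DD u}"
proof -
  have "\<not> reducible (S_DD :: ('x, 'k) free_L set) u" if "normal_DD u" for u
  proof
    assume "reducible (S_DD :: ('x, 'k) free_L set) u"
    then obtain s v where "s \<in> (S_DD :: ('x, 'k) free_L set)" "star_word v"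
      "u = replace_star v (word_of (lead s))"
      unfolding reducible_def by blast
    with that normal_DD_replace_star[of v "word_of (lead s)"] not_normal_DD_lead[of s]
    show False by (auto simp: star_word_def)
  qed
  then show ?thesis
    unfolding word_of_Irr using normal_DD_imp_normal_L reducible_if_not_normal_DD by blast
qed


section \<open>Normal DD-words span\<close>

context dendriform_algebra
begin

abbreviation DD_span :: "('x \<Rightarrow> 'd) \<Rightarrow> 'd set" where
  "DD_span \<phi> \<equiv> span (eval_word \<phi> ` {u. normal_DD u})"

lemma DD_span_base: "normal_DD u \<Longrightarrow> eval_word \<phi> u \<in> DD_span \<phi>"
  by (intro span_base) auto

lemma DD_span_linear:
  assumes "Vector_Spaces.linear scale scale f"
    and "\<And>u. normal_DD u \<Longrightarrow> f (eval_word \<phi> u) \<in> DD_span \<phi>" and "a \<in> DD_span \<phi>"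
  shows "f a \<in> DD_span \<phi>"
proof -
  interpret f: Vector_Spaces.linear scale scale f by fact
  show ?thesis
    using assms(3)
  proof (induction rule: span_induct_alt)
    case base
    show ?case by (simp add: f.zero span_zero)
  next
    case (step c x y)
    then show ?case using assms(2) by (auto simp: f.add f.scale intro!: span_add span_scale)
  qed
qed

lemma DD_span_Gen_prec:
  assumes "a \<in> DD_span \<phi>"
  shows "prec (\<phi> x) a \<in> DD_span \<phi>"
proof (rule DD_span_linear[OF linear_prec_right _ assms])
  fix v :: "'a lword" assume "normal_DD v"
  then show "prec (\<phi> x) (eval_word \<phi> v) \<in> DD_span \<phi>"
    using DD_span_base[of "Gen x [\<prec>] v" \<phi>] by simp
qed

lemma DD_span_Gen_succ:
  assumes "a \<in> DD_span \<phi>"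
  shows "succ (\<phi> x) a \<in> DD_span \<phi>"
proof (rule DD_span_linear[OF linear_succ_right _ assms])
  fix v :: "'a lword" assume "normal_DD v"
  then show "succ (\<phi> x) (eval_word \<phi> v) \<in> DD_span \<phi>"
    using DD_span_base[of "Gen x [\<succ>] v" \<phi>] by simp
qed

text \<open>By linearity in both arguments it suffices to insert normal DD-words, where the last
  clause of \<open>normal_DD\<close> applies.\<close>

lemma DD_span_Gen_succ_succ:
  assumes "a \<in> DD_span \<phi>" "b \<in> DD_span \<phi>"
  shows "succ (succ (\<phi> x) a) b \<in> DD_span \<phi>"
proof (rule DD_span_linear[OF linear_succ_right _ assms(2)])
  fix v :: "'a lword" assume v: "normal_DD v"
  have lin: "Vector_Spaces.linear scale scale (\<lambda>a. succ (succ (\<phi> x) a) (eval_word \<phi> v))"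
    by (simp add: Vector_Spaces.linear_iff vector_space_axioms sl.add sl.scale sr.add sr.scale)
  show "succ (succ (\<phi> x) a) (eval_word \<phi> v) \<in> DD_span \<phi>"
  proof (rule DD_span_linear[OF lin _ assms(1)])
    fix u :: "'a lword" assume "normal_DD u"
    with v show "succ (succ (\<phi> x) (eval_word \<phi> u)) (eval_word \<phi> v) \<in> DD_span \<phi>"
      using DD_span_base[of "(Gen x [\<succ>] u) [\<succ>] v" \<phi>] by simp
  qed
qed

text \<open>The two operations are treated together because \<open>(x \<prec> v) \<prec> a\<close>
  expands into both products of \<open>v\<close> with \<open>a\<close>.\<close>

lemma DD_span_word_prec_succ:
  assumes "normal_DD u" "a \<in> DD_span \<phi>"
  shows "prec (eval_word \<phi> u) a \<in> DD_span \<phi> \<and> succ (eval_word \<phi> u) a \<in> DD_span \<phi>"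
  using assms
proof (induction u arbitrary: a rule: normal_DD.induct)
  case (1 x)
  then show ?case using DD_span_Gen_prec[of a \<phi> x] DD_span_Gen_succ[of a \<phi> x] by simp
next
  case (2 v x)
  let ?x = "\<phi> x" and ?v = "eval_word \<phi> v"
  have v: "prec ?v a \<in> DD_span \<phi>" "succ ?v a \<in> DD_span \<phi>"
    using 2 by auto
  have "prec (prec ?x ?v) a \<in> DD_span \<phi>"
    unfolding prec_prec
    by (rule span_add[OF DD_span_Gen_prec[OF v(1)] DD_span_Gen_prec[OF v(2)]])
  moreover have "succ (prec ?x ?v) a = succ ?x (succ ?v a) - succ (succ ?x ?v) a"
    by (simp add: succ_succ)
  then have "succ (prec ?x ?v) a \<in> DD_span \<phi>"
    using DD_span_Gen_succ[OF v(2)] DD_span_Gen_succ_succ[OF DD_span_base "2.prems"] "2.hyps"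
    by (simp add: span_diff)
  ultimately show ?case by simp
next
  case (3 v x)
  then have "prec (eval_word \<phi> v) a \<in> DD_span \<phi>" by simp
  then show ?case
    using DD_span_Gen_succ[of "prec (eval_word \<phi> v) a" \<phi> x] DD_span_Gen_succ_succ[OF DD_span_base "3.prems"] "3.hyps"
    by (simp add: succ_prec)
next
  case (4 v w x)
  let ?x = "\<phi> x" and ?v = "eval_word \<phi> v" and ?w = "eval_word \<phi> w"
  \<comment> \<open>The induction hypothesis for \<open>v\<close> is used with \<open>w\<close> as
    right factor, hence the arbitrary \<open>a\<close>.\<close>
  have v: "?v \<in> DD_span \<phi>" "prec ?v ?w \<in> DD_span \<phi>"
    using 4 DD_span_base[of v \<phi>] DD_span_base[of w \<phi>] by auto
  have w: "prec ?w a \<in> DD_span \<phi>" "succ ?w a \<in> DD_span \<phi>"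
    using 4 by auto
  have "prec (succ (succ ?x ?v) ?w) a \<in> DD_span \<phi>"
    unfolding succ_prec by (rule DD_span_Gen_succ_succ[OF v(1) w(1)])
  \<comment> \<open>This is the relation \<open>DD_f3\<close>, solved for its leading term.\<close>
  moreover have "succ (succ (succ ?x ?v) ?w) a =
      succ (succ ?x ?v) (succ ?w a) - succ (succ ?x (prec ?v ?w)) a"
    using succ_succ[of "succ ?x ?v" ?w a] by (simp add: succ_prec)
  then have "succ (succ (succ ?x ?v) ?w) a \<in> DD_span \<phi>"
    using DD_span_Gen_succ_succ[OF v(1) w(2)] DD_span_Gen_succ_succ[OF v(2) "4.prems"]
    by (simp add: span_diff)
  ultimately show ?case by simp
qed

lemma DD_span_prec:
  assumes "a \<in> DD_span \<phi>" "b \<in> DD_span \<phi>"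
  shows "prec a b \<in> DD_span \<phi>"
  by (rule DD_span_linear[OF linear_prec_left _ assms(1)]) (simp add: DD_span_word_prec_succ assms(2))

lemma DD_span_succ:
  assumes "a \<in> DD_span \<phi>" "b \<in> DD_span \<phi>"
  shows "succ a b \<in> DD_span \<phi>"
  by (rule DD_span_linear[OF linear_succ_left _ assms(1)]) (simp add: DD_span_word_prec_succ assms(2))

lemma eval_word_in_DD_span: "eval_word \<phi> u \<in> DD_span \<phi>"
proof (induction u)
  case (Gen x)
  show ?case by (rule DD_span_base) simp
qed (simp_all add: DD_span_prec DD_span_succ)

end

section \<open>Spanning in the quotient\<close>

lemma DD_word_eq_eval_word:
  "DD_word u = (DD.eval_word (\<lambda>x. DD_word (ngen x)) (word_of u) :: ('x, 'k::field) DD)"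
proof -
  have "DD_word (nword_of w) = (DD.eval_word (\<lambda>x. DD_word (ngen x)) w :: ('x, 'k) DD)"
    if "normal_L w" for w
    using that
  proof (induction w)
    case (Gen x)
    then show ?case by (simp add: ngen_def)
  next
    case (WSucc u v)
    have "DD_word (nword_of (u [\<succ>] v)) =
        (DD_succ (DD_word (nword_of u)) (DD_word (nword_of v)) :: ('x, 'k) DD)"
      using WSucc.prems by (simp add: DD_word_def DD_succ.abs_eq nsucc.abs_eq eq_onp_def)
    with WSucc show ?case by simp
  next
    case (WPrec u v)
    \<comment> \<open>In a normal word the left factor of \<prec> is not a \<succ>-product, so the
      bracket does not rewrite.\<close>
    then have "bracket_prec u v = u [\<prec>] v"
      by (simp add: bracket_prec_not_succ)
    then have "DD_word (nword_of (u [\<prec>] v)) =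
        (DD_prec (DD_word (nword_of u)) (DD_word (nword_of v)) :: ('x, 'k) DD)"
      using WPrec.prems by (simp add: DD_word_def DD_prec.abs_eq nprec.abs_eq eq_onp_def)
    with WPrec show ?case by simp
  qed
  from this[of "word_of u"] show ?thesis
    using word_of[of u] by (simp add: word_of_inverse)
qed

theorem span_DD_word_normal_DD:
  "DD.span ((DD_word :: 'x nword \<Rightarrow> ('x, 'k::field) DD) ` {u. normal_DD (word_of u)}) = UNIV"
    (is "DD.span ?B = _")
proof -
  have "{u :: 'x lword. normal_DD u} = word_of ` {u. normal_DD (word_of u)}"
    by (auto simp: image_iff) (metis mem_Collect_eq nword_of_inverse normal_DD_imp_normal_L)
  then have B: "DD.eval_word (\<lambda>x. DD_word (ngen x)) ` {u. normal_DD u} = ?B"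
    by (simp only: image_image flip: DD_word_eq_eval_word)
  have word: "DD_word u \<in> DD.span ?B" for u
    unfolding B[symmetric] by (subst DD_word_eq_eval_word) (rule DD.eval_word_in_DD_span)
  have "DD_class f \<in> DD.span ?B" for f
  proof (induction f rule: free_L_induct)
    case (word u)
    show ?case using \<open>DD_word u \<in> DD.span ?B\<close> by (simp add: DD_word_def)
  next
    case (add f g)
    then show ?case by (simp add: plus_DD.abs_eq[symmetric] DD.span_add)
  next
    case (scale c f)
    then show ?case by (simp add: DD_scale.abs_eq[symmetric] DD.span_scale)
  qed
  then have "a \<in> DD.span ?B" for a by (induction a rule: DD.abs_induct)
  then show ?thesis by blast
qed


section \<open>An algebra on the normal DD-words\<close>

text \<open>The recursion on the left factor reads the dendriform relations as rewriting rules. The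
  dendriform identities then follow by structural induction on the leftmost factor, which replaces
  the check of compositions in the Groebner--Shirshov argument.\<close>

datatype 'x dd =
    DGen 'x
  | DPrec 'x "'x dd"
  | DSucc 'x "'x dd"
  | DSuccSucc 'x "'x dd" "'x dd"

primrec lword_of_dd :: "'x dd \<Rightarrow> 'x lword" where
  "lword_of_dd (DGen x) = Gen x"
| "lword_of_dd (DPrec x v) = Gen x [\<prec>] lword_of_dd v"
| "lword_of_dd (DSucc x v) = Gen x [\<succ>] lword_of_dd v"
| "lword_of_dd (DSuccSucc x u v) = (Gen x [\<succ>] lword_of_dd u) [\<succ>] lword_of_dd v"

lemma normal_DD_lword_of_dd: "normal_DD (lword_of_dd d)"
  by (induction d) auto

lemma normal_DD_iff: "normal_DD u \<longleftrightarrow> (\<exists>d. u = lword_of_dd d)"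
proof
  assume "normal_DD u"
  then show "\<exists>d. u = lword_of_dd d"
    by (induction rule: normal_DD.induct) (metis lword_of_dd.simps)+
qed (auto simp: normal_DD_lword_of_dd)

section \<open>Linear combinations over an arbitrary basis\<close>

definition pm_scale :: "'k::field \<Rightarrow> ('a \<Rightarrow>\<^sub>0 'k) \<Rightarrow> ('a \<Rightarrow>\<^sub>0 'k)" where
  "pm_scale c f = Poly_Mapping.map ((*) c) f"

abbreviation pm_basis :: "'a \<Rightarrow> ('a \<Rightarrow>\<^sub>0 'k::field)" where
  "pm_basis a \<equiv> Poly_Mapping.single a 1"

lemma lookup_pm_scale [simp]: "Poly_Mapping.lookup (pm_scale c f) a = c * Poly_Mapping.lookup f a"
  by (simp add: pm_scale_def Poly_Mapping.map.rep_eq when_def)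

interpretation pm: vector_space "pm_scale :: 'k::field \<Rightarrow> ('a \<Rightarrow>\<^sub>0 'k) \<Rightarrow> ('a \<Rightarrow>\<^sub>0 'k)"
  by unfold_locales (auto intro!: poly_mapping_eqI simp: lookup_add algebra_simps)

lemma pm_induct [case_names basis add scale]:
  fixes f :: "'a \<Rightarrow>\<^sub>0 'k::field"
  assumes basis: "\<And>a. P (pm_basis a)"
    and add: "\<And>f g. P f \<Longrightarrow> P g \<Longrightarrow> P (f + g)"
    and scale: "\<And>c f. P f \<Longrightarrow> P (pm_scale c f)"
  shows "P f"
proof (induction f rule: update_induct)
  case const
  have "P (pm_scale 0 (pm_basis undefined))" by (rule scale, rule basis)
  then show ?case by simp
next
  case (update f a b)
  have "Poly_Mapping.update a b f = f + pm_scale b (pm_basis a)"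
    using update(1) by (intro poly_mapping_eqI)
      (auto simp: lookup_add lookup_single when_def update.rep_eq in_keys_iff)
  then show ?case using update add scale basis by simp
qed

definition pm_ext :: "('a \<Rightarrow> ('b \<Rightarrow>\<^sub>0 'k::field)) \<Rightarrow> ('a \<Rightarrow>\<^sub>0 'k) \<Rightarrow> ('b \<Rightarrow>\<^sub>0 'k)" where
  "pm_ext \<phi> f = (\<Sum>a\<in>Poly_Mapping.keys f. pm_scale (Poly_Mapping.lookup f a) (\<phi> a))"

lemma pm_ext_basis [simp]: "pm_ext \<phi> (pm_basis a) = \<phi> a"
  by (simp add: pm_ext_def)

lemma pm_ext_add [simp]: "pm_ext \<phi> (f + g) = pm_ext \<phi> f + pm_ext \<phi> g"
  unfolding pm_ext_def by (rule setsum_keys_plus_distrib) (simp_all add: pm.scale_left_distrib)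

lemma pm_ext_scale [simp]: "pm_ext \<phi> (pm_scale c f) = pm_scale c (pm_ext \<phi> f)"
proof -
  have "pm_ext \<phi> (pm_scale c f) =
      (\<Sum>a\<in>Poly_Mapping.keys f. pm_scale (Poly_Mapping.lookup (pm_scale c f) a) (\<phi> a))"
    unfolding pm_ext_def by (rule sum.mono_neutral_left) (auto simp: in_keys_iff)
  then show ?thesis by (simp add: pm_ext_def pm.scale_sum_right)
qed

lemma pm_ext_diff [simp]: "pm_ext \<phi> (f - g) = pm_ext \<phi> f - pm_ext \<phi> g"
  by (metis add_diff_cancel diff_add_cancel pm_ext_add)

lemma pm_ext_fun_add [simp]: "pm_ext (\<lambda>a. \<phi> a + \<psi> a) f = pm_ext \<phi> f + pm_ext \<psi> f"
  by (simp add: pm_ext_def pm.scale_right_distrib sum.distrib)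

lemma pm_ext_fun_scale [simp]: "pm_ext (\<lambda>a. pm_scale c (\<phi> a)) f = pm_scale c (pm_ext \<phi> f)"
  by (simp add: pm_ext_def pm.scale_sum_right mult.commute)

section \<open>The two products and their identities\<close>

abbreviation lift_Prec :: "'x \<Rightarrow> ('x dd \<Rightarrow>\<^sub>0 'k::field) \<Rightarrow> ('x dd \<Rightarrow>\<^sub>0 'k)" where
  "lift_Prec x \<equiv> pm_ext (\<lambda>a. pm_basis (DPrec x a))"

abbreviation lift_Succ :: "'x \<Rightarrow> ('x dd \<Rightarrow>\<^sub>0 'k::field) \<Rightarrow> ('x dd \<Rightarrow>\<^sub>0 'k)" where
  "lift_Succ x \<equiv> pm_ext (\<lambda>a. pm_basis (DSucc x a))"

abbreviation lift_SuccSucc ::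
    "'x \<Rightarrow> ('x dd \<Rightarrow>\<^sub>0 'k::field) \<Rightarrow> ('x dd \<Rightarrow>\<^sub>0 'k) \<Rightarrow> ('x dd \<Rightarrow>\<^sub>0 'k)" where
  "lift_SuccSucc x f g \<equiv> pm_ext (\<lambda>a. pm_ext (\<lambda>b. pm_basis (DSuccSucc x a b)) g) f"

text \<open>The right argument is a linear combination because recursive calls return combinations;
  the left one is a single word that shrinks. The negative terms come from solving
  \<open>DD_f2\<close> and \<open>DD_f3\<close> for their leading terms.\<close>

fun word_prec word_succ :: "'x dd \<Rightarrow> ('x dd \<Rightarrow>\<^sub>0 'k::field) \<Rightarrow> ('x dd \<Rightarrow>\<^sub>0 'k)" where
  "word_prec (DGen x) f = lift_Prec x f"
| "word_prec (DPrec x a) f = lift_Prec x (word_prec a f + word_succ a f)"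
| "word_prec (DSucc x a) f = lift_Succ x (word_prec a f)"
| "word_prec (DSuccSucc x a b) f = lift_SuccSucc x (pm_basis a) (word_prec b f)"
| "word_succ (DGen x) f = lift_Succ x f"
| "word_succ (DPrec x a) f = lift_Succ x (word_succ a f) - lift_SuccSucc x (pm_basis a) f"
| "word_succ (DSucc x a) f = lift_SuccSucc x (pm_basis a) f"
| "word_succ (DSuccSucc x a b) f =
    lift_SuccSucc x (pm_basis a) (word_succ b f) - lift_SuccSucc x (word_prec a (pm_basis b)) f"

lemma word_prec_succ_add [simp]:
  "word_prec u (f + g) = word_prec u f + word_prec u g"
  "word_succ u (f + g) = word_succ u f + word_succ u g"
  by (induction u) (simp_all add: algebra_simps)

lemma word_prec_succ_scale [simp]:
  "word_prec u (pm_scale c f) = pm_scale c (word_prec u f)"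
  "word_succ u (pm_scale c f) = pm_scale c (word_succ u f)"
  by (induction u) (simp_all add: pm.scale_right_distrib pm.scale_right_diff_distrib)

definition dd_prec :: "('x dd \<Rightarrow>\<^sub>0 'k::field) \<Rightarrow> ('x dd \<Rightarrow>\<^sub>0 'k) \<Rightarrow> ('x dd \<Rightarrow>\<^sub>0 'k)" where
  "dd_prec f g = pm_ext (\<lambda>u. word_prec u g) f"

definition dd_succ :: "('x dd \<Rightarrow>\<^sub>0 'k::field) \<Rightarrow> ('x dd \<Rightarrow>\<^sub>0 'k) \<Rightarrow> ('x dd \<Rightarrow>\<^sub>0 'k)" where
  "dd_succ f g = pm_ext (\<lambda>u. word_succ u g) f"

lemma dd_basis [simp]:
  "dd_prec (pm_basis u) g = word_prec u g"
  "dd_succ (pm_basis u) g = word_succ u g"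
  by (simp_all add: dd_prec_def dd_succ_def)

lemma dd_linear [simp]:
  "dd_prec (f + f') g = dd_prec f g + dd_prec f' g"
  "dd_prec f (g + g') = dd_prec f g + dd_prec f g'"
  "dd_prec (f - f') g = dd_prec f g - dd_prec f' g"
  "dd_prec (pm_scale c f) g = pm_scale c (dd_prec f g)"
  "dd_prec f (pm_scale c g) = pm_scale c (dd_prec f g)"
  "dd_succ (f + f') g = dd_succ f g + dd_succ f' g"
  "dd_succ f (g + g') = dd_succ f g + dd_succ f g'"
  "dd_succ (f - f') g = dd_succ f g - dd_succ f' g"
  "dd_succ (pm_scale c f) g = pm_scale c (dd_succ f g)"
  "dd_succ f (pm_scale c g) = pm_scale c (dd_succ f g)"
  by (simp_all add: dd_prec_def dd_succ_def)

text \<open>This and the next five lemmas extend the recursion clauses from subwords to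
  combinations, as needed once a product is multiplied again.\<close>

lemma dd_prec_lift_Prec [simp]:
  "dd_prec (lift_Prec x c) f = lift_Prec x (dd_prec c f + dd_succ c f)"
  by (induction c rule: pm_induct) (simp_all add: pm.scale_right_distrib)

lemma dd_succ_lift_Prec [simp]:
  "dd_succ (lift_Prec x c) f = lift_Succ x (dd_succ c f) - lift_SuccSucc x c f"
  by (induction c rule: pm_induct) (simp_all add: pm.scale_right_diff_distrib)

lemma dd_prec_lift_Succ [simp]:
  "dd_prec (lift_Succ x c) f = lift_Succ x (dd_prec c f)"
  by (induction c rule: pm_induct) simp_all

lemma dd_succ_lift_Succ [simp]:
  "dd_succ (lift_Succ x c) f = lift_SuccSucc x c f"
  by (induction c rule: pm_induct) simp_all

lemma dd_prec_lift_SuccSucc [simp]: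
  "dd_prec (lift_SuccSucc x c d) f = lift_SuccSucc x c (dd_prec d f)"
proof (induction c rule: pm_induct)
  case (basis a)
  show ?case by (induction d rule: pm_induct) simp_all
qed simp_all

lemma dd_succ_lift_SuccSucc [simp]:
  "dd_succ (lift_SuccSucc x c d) f =
    lift_SuccSucc x c (dd_succ d f) - lift_SuccSucc x (dd_prec c d) f"
proof (induction c rule: pm_induct)
  case (basis a)
  show ?case
    by (induction d rule: pm_induct) (simp_all add: pm.scale_right_diff_distrib)
qed (simp_all add: pm.scale_right_diff_distrib)

text \<open>The simplifier evaluates \<open>lift_SuccSucc x (pm_basis a)\<close> to a single
  \<open>pm_ext\<close>, on which the general rules no longer match.\<close>

lemmas dd_lift_SuccSucc_basis [simp] =
  dd_prec_lift_SuccSucc[where c = "pm_basis _", simplified]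
  dd_succ_lift_SuccSucc[where c = "pm_basis _", simplified]

text \<open>The induction must be simultaneous: the second identity for \<open>DPrec x a\<close>
  needs all three for \<open>a\<close>. The third one for \<open>DSuccSucc x a b\<close> uses the
  second one for \<open>a\<close> with \<open>pm_basis b\<close> as middle factor, hence the
  arbitrary \<open>g\<close> and \<open>h\<close>.\<close>

lemma dd_word_identities:
  "dd_prec (word_succ u g) h = word_succ u (dd_prec g h)"
  "dd_prec (word_prec u g) h = word_prec u (dd_prec g h) + word_prec u (dd_succ g h)"
  "word_succ u (dd_succ g h) = dd_succ (word_succ u g) h + dd_succ (word_prec u g) h"
  by (induction u arbitrary: g h) (simp_all add: algebra_simps)

interpretation dd: dendriform_algebra
  "pm_scale :: 'k::field \<Rightarrow> ('x dd \<Rightarrow>\<^sub>0 'k) \<Rightarrow> ('x dd \<Rightarrow>\<^sub>0 'k)" dd_succ dd_prec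
proof unfold_locales
  fix x y z :: "'x dd \<Rightarrow>\<^sub>0 'k"
  show "dd_prec (dd_succ x y) z = dd_succ x (dd_prec y z)"
    by (induction x rule: pm_induct) (simp_all add: dd_word_identities)
  show "dd_prec (dd_prec x y) z = dd_prec x (dd_prec y z) + dd_prec x (dd_succ y z)"
    by (induction x rule: pm_induct) (simp_all add: dd_word_identities pm.scale_right_distrib)
  show "dd_succ x (dd_succ y z) = dd_succ (dd_succ x y) z + dd_succ (dd_prec x y) z"
    by (induction x rule: pm_induct) (simp_all add: dd_word_identities pm.scale_right_distrib)
qed simp_all

text \<open>Normal DD-words are never rewritten: each of their products hits a clause returning one
  basis vector.\<close>

lemma eval_word_lword_of_dd: "dd.eval_word (\<lambda>x. pm_basis (DGen x)) (lword_of_dd d) = pm_basis d"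
  by (induction d) simp_all


section \<open>Normal DD-words are independent\<close>

text \<open>Apply \<open>h\<close> to a linear relation and read off the coefficient at
  \<open>j i\<close>: only the coefficient of \<open>b i\<close> survives. Injectivity of
  \<open>b\<close> comes first because independence concerns the image set.\<close>

lemma (in vector_space) independent_of_linear_to_pm:
  assumes h: "Vector_Spaces.linear scale pm_scale h"
    and basis: "\<And>i. i \<in> I \<Longrightarrow> h (b i) = pm_basis (j i)" and inj: "inj_on j I"
  shows "inj_on b I" "independent (b ` I)"
proof -
  interpret h: Vector_Spaces.linear scale pm_scale h by fact
  show inj_b: "inj_on b I"
  proof (rule inj_onI)
    fix i i' assume i: "i \<in> I" "i' \<in> I" "b i = b i'"
    then have "pm_basis (j i) = (pm_basis (j i') :: _ \<Rightarrow>\<^sub>0 'a)" by (metis basis)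
    then have "j i = j i'" by (metis lookup_single_eq lookup_single_not_eq one_neq_zero)
    with i inj show "i = i'" by (simp add: inj_on_eq_iff)
  qed
  show "independent (b ` I)"
    unfolding independent_explicit_module
  proof (intro allI impI)
    fix t u v assume t: "finite t" "t \<subseteq> b ` I" "(\<Sum>v\<in>t. scale (u v) v) = 0" "v \<in> t"
    then obtain i where i: "i \<in> I" "v = b i" by blast
    have "(\<Sum>w\<in>t. u w * Poly_Mapping.lookup (h w) (j i)) =
        Poly_Mapping.lookup (h (\<Sum>w\<in>t. scale (u w) w)) (j i)"
      by (simp add: h.sum h.scale lookup_sum)
    also have "\<dots> = 0" using t by (simp add: h.zero)
    also have "(\<Sum>w\<in>t. u w * Poly_Mapping.lookup (h w) (j i)) = (\<Sum>w\<in>t. if w = v then u v else 0)"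
    proof (rule sum.cong)
      fix w assume "w \<in> t"
      with t obtain i' where i': "i' \<in> I" "w = b i'" by blast
      with i inj show "u w * Poly_Mapping.lookup (h w) (j i) = (if w = v then u v else 0)"
        by (auto simp: basis lookup_single when_def inj_on_eq_iff[OF inj] inj_on_eq_iff[OF inj_b])
    qed simp
    finally show "u v = 0" using t by simp
  qed
qed

theorem DD_word_normal_DD_independent:
  fixes I :: "'x nword set"
  defines "I \<equiv> {u. normal_DD (word_of u)}"
  shows "inj_on (DD_word :: 'x nword \<Rightarrow> ('x, 'k::field) DD) I"
    and "DD.independent ((DD_word :: 'x nword \<Rightarrow> ('x, 'k) DD) ` I)"
proof -
  let ?\<phi> = "\<lambda>x. pm_basis (DGen x) :: 'x dd \<Rightarrow>\<^sub>0 'k"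
  let ?h = "dd.eval_DD ?\<phi>"
  \<comment> \<open>On \<open>I\<close> the chosen code of a word maps back to it under
    \<open>lword_of_dd\<close>, so the choice is injective.\<close>
  let ?j = "\<lambda>u. SOME d. word_of u = lword_of_dd d"
  have add: "?h (a + b) = ?h a + ?h b" for a b
    by (induction a rule: DD.abs_induct; induction b rule: DD.abs_induct)
      (simp add: plus_DD.abs_eq dd.eval_DD_class)
  have sc: "?h (DD_scale c a) = pm_scale c (?h a)" for c a
    by (induction a rule: DD.abs_induct) (simp add: DD_scale.abs_eq dd.eval_DD_class)
  have h: "Vector_Spaces.linear DD_scale pm_scale ?h"
    by (simp add: Vector_Spaces.linear_iff add sc DD.vector_space_axioms pm.vector_space_axioms)
  have j: "word_of u = lword_of_dd (?j u)" if "u \<in> I" for u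
    using that by (intro someI_ex[of "\<lambda>d. word_of u = lword_of_dd d"])
      (simp add: I_def normal_DD_iff)
  have basis: "?h (DD_word u) = pm_basis (?j u)" if "u \<in> I" for u
  proof -
    have "?h (DD_word u) = dd.eval_word ?\<phi> (lword_of_dd (?j u))"
      by (simp add: DD_word_def dd.eval_DD_class flip: j[OF that])
    then show ?thesis by (simp add: eval_word_lword_of_dd)
  qed
  have inj: "inj_on ?j I"
    by (rule inj_onI) (metis j word_of_inject)
  show "inj_on (DD_word :: 'x nword \<Rightarrow> ('x, 'k) DD) I"
    and "DD.independent ((DD_word :: 'x nword \<Rightarrow> ('x, 'k) DD) ` I)"
    by (rule DD.independent_of_linear_to_pm[OF h basis inj]; assumption)+
qed

theorem corollary3p4:
  shows "word_of ` Irr (S_DD :: ('x::wellorder, 'k::field) free_L set) = {u. normal_DD u} \<and>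
    inj_on (DD_word :: 'x nword \<Rightarrow> ('x, 'k) DD) (Irr (S_DD :: ('x, 'k) free_L set)) \<and>
    DD.independent ((DD_word :: 'x nword \<Rightarrow> ('x, 'k) DD) ` Irr (S_DD :: ('x, 'k) free_L set)) \<and>
    DD.span ((DD_word :: 'x nword \<Rightarrow> ('x, 'k) DD) ` Irr (S_DD :: ('x, 'k) free_L set)) = UNIV"
proof -
  \<comment> \<open>Injectivity of \<open>word_of\<close> transfers the equality from raw words to
    the type of normal words.\<close>
  have "Irr (S_DD :: ('x, 'k) free_L set) = {u. normal_DD (word_of u)}"
    using Irr_S_DD[where 'x='x and 'k='k] by (auto simp: set_eq_iff image_iff) (metis word_of_inject)+
  then show ?thesis
    using Irr_S_DD[where 'x='x and 'k='k] DD_word_normal_DD_independent[where 'x='x and 'k='k]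
      span_DD_word_normal_DD[where 'x='x and 'k='k]
    by simp
qed

end
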